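(* Let $n$ and $k$ be positive integers with $k>1$ and $n\geqslant k(k+1)$. Then the total Roman domination number of the Kneser graph $K_{n,k}$ satisfies $\gamma_{tR}(K_{n,k}) = 2(k+1)$.
   Context: For positive integers $n,k$, the Kneser graph $K_{n,k}$ is the simple graph whose vertices are all $k$-element subsets of $\{1,2,\dots,n\}$, two vertices being adjacent if and only if the corresponding sets are disjoint. Let $G=(V,E)$ be a finite simple graph and, for $v\in V$, let $N(v)=\{u\in V \mid uv\in E\}$ be the open neighborhood of $v$. A total Roman domination function (TRDF) on $G$ is a function $f:V\to\{0,1,2\}$ such that: (1) every vertex $v$ with $f(v)=0$ has a neighbor $u$ with $f(u)=2$; and (2) for every $v\in V$, $\sum_{u\in N(v)}f(u)\geqslant 1$. The weight of $f$ is $f(V)=\sum_{v\in V}f(v)$. The total Roman domination number $\gamma_{tR}(G)$ is the minimum weight over all TRDFs on $G$. *)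

theory Defs
  imports "Graph_Theory.Pair_Digraph"
begin

text \<open>
  A finite simple graph is a \<^locale>\<open>pair_graph\<close>: a finite loop-free digraph whose arc set is a
  symmetric set of pairs, an edge \<open>uv\<close> being the two arcs \<open>(u, v)\<close> and \<open>(v, u)\<close>.
\<close>

definition kneser :: "nat \<Rightarrow> nat \<Rightarrow> nat set pair_pre_digraph" where
  "kneser n k =
     (let V = {A. A \<subseteq> {1..n} \<and> card A = k}
      in \<lparr> pverts = V, parcs = {(A, B). A \<in> V \<and> B \<in> V \<and> A \<inter> B = {}} \<rparr>)"

lemma pverts_kneser: "A \<in> pverts (kneser n k) \<longleftrightarrow> A \<subseteq> {1..n} \<and> card A = k"
  unfolding kneser_def Let_def pair_pre_digraph.simps mem_Collect_eq ..

lemma parcs_kneser: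
  "(A, B) \<in> parcs (kneser n k) \<longleftrightarrow>
     A \<in> pverts (kneser n k) \<and> B \<in> pverts (kneser n k) \<and> A \<inter> B = {}"
  unfolding kneser_def Let_def pair_pre_digraph.simps mem_Collect_eq prod.case ..

text \<open>For \<open>k = 0\<close> the empty set would be adjacent to itself.\<close>

lemma pair_graph_kneser:
  assumes "k > 0"
  shows "pair_graph (kneser n k)"
proof
  have "pverts (kneser n k) \<subseteq> Pow {1..n}"
    using pverts_kneser by blast
  then show fin: "finite (pverts (kneser n k))"
    by (rule finite_subset) (rule finite_Pow_iff[THEN iffD2, OF finite_atLeastAtMost])
  have "parcs (kneser n k) \<subseteq> pverts (kneser n k) \<times> pverts (kneser n k)"
    using parcs_kneser by fast
  then show "finite (parcs (kneser n k))"
    by (rule finite_subset[OF _ finite_cartesian_product[OF fin fin]])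
  have "sym (parcs (kneser n k))"
    by (rule symI) (metis parcs_kneser Int_commute)
  then show "symmetric (with_proj (kneser n k))"
    by (simp only: symmetric_def arcs_ends_conv with_proj_simps prod.collapse image_ident)
next
  fix e assume "e \<in> parcs (kneser n k)"
  moreover obtain A B where e: "e = (A, B)"
    by (rule prod.exhaust)
  ultimately have AB: "A \<in> pverts (kneser n k)" "B \<in> pverts (kneser n k)" "A \<inter> B = {}"
    by (simp_all only: parcs_kneser)
  show "fst e \<in> pverts (kneser n k)" "snd e \<in> pverts (kneser n k)"
    using AB by (simp_all only: e fst_conv snd_conv)
  have "A \<noteq> {}"
    using AB(1) assms by (metis pverts_kneser card.empty less_irrefl)
  then show "fst e \<noteq> snd e"
    using AB(3) by (metis e fst_conv snd_conv Int_absorb)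
qed

definition open_nbhd :: "'a pair_pre_digraph \<Rightarrow> 'a \<Rightarrow> 'a set" where
  "open_nbhd G v = {u \<in> pverts G. (u, v) \<in> parcs G}"

text \<open>Values of \<open>f\<close> outside the vertex set are unconstrained and play no role.\<close>

definition is_TRDF :: "'a pair_pre_digraph \<Rightarrow> ('a \<Rightarrow> nat) \<Rightarrow> bool" where
  "is_TRDF G f \<longleftrightarrow>
     (\<forall>v \<in> pverts G. f v \<in> {0, 1, 2}) \<and>
     (\<forall>v \<in> pverts G. f v = 0 \<longrightarrow> (\<exists>u \<in> open_nbhd G v. f u = 2)) \<and>
     (\<forall>v \<in> pverts G. (\<Sum>u \<in> open_nbhd G v. f u) \<ge> 1)"

definition weight :: "'a pair_pre_digraph \<Rightarrow> ('a \<Rightarrow> nat) \<Rightarrow> nat" where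
  "weight G f = (\<Sum>v \<in> pverts G. f v)"

text \<open>
  The minimum exists as soon as \<open>G\<close> has a total Roman domination function; otherwise the
  value is unspecified.
\<close>

definition total_Roman_domination_number :: "'a pair_pre_digraph \<Rightarrow> nat" where
  "total_Roman_domination_number G = (LEAST w. \<exists>f. is_TRDF G f \<and> weight G f = w)"

end

theory Submission
  imports Defs
begin

text \<open>
  A family of \<open>k + 1\<close> pairwise disjoint vertices, each of value \<open>2\<close>, is a total Roman domination
  function because a \<open>k\<close>-set meets at most \<open>k\<close> of them.  Conversely, let \<open>f\<close> have weight at most
  \<open>2 * k + 1\<close>, let \<open>S\<close> be its support and \<open>W\<close> the set of vertices of value \<open>2\<close>; then
  \<open>card S + card W \<le> 2 * k + 1\<close>, every \<open>k\<close>-set meeting all of \<open>W\<close> lies in \<open>S\<close>, and no \<open>k\<close>-set meets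
  all of \<open>S\<close>.  If some \<open>(k - 1)\<close>-set \<open>T\<close> meets all of \<open>W\<close>, then its \<open>n - k + 1 \<ge> k\<^sup>2 + 1\<close> extensions
  to \<open>k\<close>-sets lie in \<open>S\<close>, so they exhaust \<open>S\<close>, and any of them meets all of \<open>S\<close>.  Otherwise \<open>W\<close>
  consists of \<open>k\<close> pairwise disjoint sets; a transversal of \<open>W\<close> lies in \<open>S - W\<close>, hence it is the only
  further element of \<open>S\<close>, and it meets all of \<open>S\<close>.
\<close>

text \<open>Choose one point in each member of \<open>F\<close>; the at most \<open>j\<close> chosen
  points are then padded inside \<open>U\<close> to exactly \<open>j\<close>.\<close>

lemma obtain_hitting_set:
  assumes "finite U" "finite F" "\<And>A. A \<in> F \<Longrightarrow> A \<noteq> {} \<and> A \<subseteq> U"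
    and "card F \<le> j" "j \<le> card U"
  obtains T where "T \<subseteq> U" "card T = j" "\<And>A. A \<in> F \<Longrightarrow> A \<inter> T \<noteq> {}"
proof -
  obtain g where g: "\<And>A. A \<in> F \<Longrightarrow> g A \<in> A"
    using assms(3) by (metis all_not_in_conv)
  have "g ` F \<subseteq> U"
    using g assms(3) by blast
  moreover have "card (g ` F) \<le> j"
    using card_image_le[OF assms(2), of g] assms(4) by linarith
  ultimately obtain T where T: "g ` F \<subseteq> T" "T \<subseteq> U" "card T = j"
    using exists_subset_between[of "g ` F" j U] assms(1,5) by blast
  have "A \<inter> T \<noteq> {}" if "A \<in> F" for A
    using that g T(1) by blast
  with T show thesis
    using that by blast
qed

lemma finite_pverts_kneser [simp]: "finite (pverts (kneser n k))"
proof (rule finite_subset)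
  show "pverts (kneser n k) \<subseteq> Pow {1..n}"
    using pverts_kneser by blast
qed simp

lemma open_nbhd_kneser:
  assumes "A \<in> pverts (kneser n k)"
  shows "open_nbhd (kneser n k) A = {B \<in> pverts (kneser n k). A \<inter> B = {}}"
  using assms by (auto simp: open_nbhd_def parcs_kneser)

lemma is_TRDF_support:
  fixes n k and f :: "nat set \<Rightarrow> nat"
  defines "S \<equiv> {v \<in> pverts (kneser n k). f v \<noteq> 0}"
    and "W \<equiv> {v \<in> pverts (kneser n k). f v = 2}"
  assumes f: "is_TRDF (kneser n k) f"
  shows "card S + card W \<le> weight (kneser n k) f"
    and "\<And>A. A \<in> pverts (kneser n k) \<Longrightarrow> \<exists>B\<in>S. A \<inter> B = {}"
    and "\<And>A. A \<in> pverts (kneser n k) \<Longrightarrow> \<forall>B\<in>W. A \<inter> B \<noteq> {} \<Longrightarrow> A \<in> S"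
proof -
  let ?V = "pverts (kneser n k)"
  \<comment> \<open>A vertex of value 1 is counted once, in \<open>S\<close>; a vertex of value 2 is
    counted twice, in \<open>S\<close> and in \<open>W\<close>.\<close>
  have "card S + card W = (\<Sum>v\<in>?V. of_bool (f v \<noteq> 0) + of_bool (f v = 2))"
    by (simp add: S_def W_def sum.distrib sum_of_bool_eq Int_def)
  also have "\<dots> \<le> weight (kneser n k) f"
    unfolding weight_def by (rule sum_mono) auto
  finally show "card S + card W \<le> weight (kneser n k) f" .
next
  fix A assume A: "A \<in> pverts (kneser n k)"
  with f have "(\<Sum>u\<in>open_nbhd (kneser n k) A. f u) \<noteq> 0"
    by (force simp: is_TRDF_def)
  then obtain B where "B \<in> open_nbhd (kneser n k) A" "f B \<noteq> 0"
    by (meson sum.neutral)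
  then show "\<exists>B\<in>S. A \<inter> B = {}"
    using A by (auto simp: open_nbhd_kneser S_def)
next
  fix A assume "A \<in> pverts (kneser n k)" "\<forall>B\<in>W. A \<inter> B \<noteq> {}"
  then show "A \<in> S"
    using f by (auto simp: is_TRDF_def open_nbhd_kneser S_def W_def)
qed

lemma weight_TRDF_kneser_ge:
  assumes k: "k > 1" and n: "n \<ge> k * (k + 1)" and f: "is_TRDF (kneser n k) f"
  shows "2 * (k + 1) \<le> weight (kneser n k) f"
proof (rule ccontr)
  let ?V = "pverts (kneser n k)"
  define S where "S = {v \<in> ?V. f v \<noteq> 0}"
  define W where "W = {v \<in> ?V. f v = 2}"
  assume "\<not> 2 * (k + 1) \<le> weight (kneser n k) f"
  then have SW: "card S + card W \<le> 2 * k + 1"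
    using is_TRDF_support(1)[OF f] by (simp add: S_def W_def)
  note S_dominates = is_TRDF_support(2)[OF f, folded S_def]
  note W_dominates = is_TRDF_support(3)[OF f, folded S_def W_def]
  have sub: "W \<subseteq> S" "S \<subseteq> ?V"
    by (auto simp: S_def W_def)
  then have fin: "finite S" "finite W"
    by (meson finite_pverts_kneser finite_subset)+
  have "card W \<le> card S"
    using fin sub by (intro card_mono) auto
  with SW have Wk: "card W \<le> k"
    by linarith
  have W: "A \<noteq> {} \<and> A \<subseteq> {1..n}" if "A \<in> W" for A
  proof -
    have "A \<subseteq> {1..n}" "card A = k"
      using that sub pverts_kneser by blast+
    then show ?thesis
      using k by auto
  qed
  have kn: "k \<le> n"
    using n k by (simp add: algebra_simps)

  have no_small_hitting_set: False
    if T: "T \<subseteq> {1..n}" "card T = k - 1" "\<And>A. A \<in> W \<Longrightarrow> A \<inter> T \<noteq> {}" for T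
  proof -
    have finT: "finite T"
      using T(1) finite_subset by blast
    define E where "E = (\<lambda>x. insert x T) ` ({1..n} - T)"
    have EV: "E \<subseteq> ?V"
      using T(1,2) k finT by (auto simp: E_def pverts_kneser)
    have ES: "E \<subseteq> S"
    proof
      fix A assume "A \<in> E"
      then show "A \<in> S"
        using T(3) EV by (intro W_dominates) (auto simp: E_def)
    qed
    have "2 * k \<le> k * k"
      using k by simp
    \<comment> \<open>The size of \<open>n\<close> enters here: \<open>E\<close> has
      \<open>n - (k - 1)\<close> members, at least as many as \<open>S\<close> can have.\<close>
    have "card S \<le> 2 * k + 1"
      using SW by simp
    also have "\<dots> \<le> n - (k - 1)"
      using n k \<open>2 * k \<le> k * k\<close> unfolding distrib_left by linarith
    also have "\<dots> = card ({1..n} - T)"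
      using T finT by (simp add: card_Diff_subset)
    also have "\<dots> = card E"
      unfolding E_def by (rule card_image[symmetric]) (auto simp: inj_on_def)
    finally have "S = E"
      using ES fin(1) card_seteq by blast
    \<comment> \<open>Any two members of \<open>E\<close> share the points of \<open>T\<close>, so a
      nonempty \<open>T\<close> rules out a disjoint pair in \<open>S = E\<close>.\<close>
    have "T \<noteq> {}"
      using T(2) k by auto
    have "T \<noteq> {1..n}"
      using T(2) kn k by auto
    then obtain A where "A \<in> E"
      using T(1) unfolding E_def by blast
    with S_dominates EV obtain B where "B \<in> E" "A \<inter> B = {}"
      unfolding \<open>S = E\<close> by blast
    with \<open>A \<in> E\<close> \<open>T \<noteq> {}\<close> show False
      by (auto simp: E_def)
  qed

  have cardW: "card W = k"
  proof (rule ccontr)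
    assume "card W \<noteq> k"
    then have "card W \<le> k - 1"
      using Wk by linarith
    moreover have "k - 1 \<le> card {1..n}"
      using kn by simp
    ultimately show False
      using obtain_hitting_set[OF _ fin(2) W] no_small_hitting_set finite_atLeastAtMost by metis
  qed
  have disj: "A \<inter> B = {}" if AB: "A \<in> W" "B \<in> W" "A \<noteq> B" for A B
  proof (rule ccontr)
    assume "A \<inter> B \<noteq> {}"
    \<comment> \<open>One point of \<open>A \<inter> B\<close> hits both sets, so merging them saves
      a point and \<open>k - 1\<close> points suffice for \<open>W\<close>.\<close>
    define F where "F = insert (A \<inter> B) (W - {A, B})"
    have "card (W - {A, B}) = k - 2"
      using AB fin(2) cardW by (simp add: card_Diff_subset)
    then have "card F \<le> k - 1"
      using k card_insert_le_m1[of "k - 1" "W - {A, B}" "A \<inter> B"] by (simp add: F_def)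
    moreover have "C \<noteq> {} \<and> C \<subseteq> {1..n}" if "C \<in> F" for C
      using that W AB \<open>A \<inter> B \<noteq> {}\<close> by (auto simp: F_def)
    moreover have "finite F"
      using fin(2) by (simp add: F_def)
    moreover have "k - 1 \<le> card {1..n}"
      using kn by simp
    ultimately obtain T where T: "T \<subseteq> {1..n}" "card T = k - 1" "\<And>C. C \<in> F \<Longrightarrow> C \<inter> T \<noteq> {}"
      using obtain_hitting_set[OF finite_atLeastAtMost] by metis
    have "C \<inter> T \<noteq> {}" if "C \<in> W" for C
      using T(3)[of C] T(3)[of "A \<inter> B"] that by (auto simp: F_def)
    with T show False
      using no_small_hitting_set by blast
  qed
  have "k \<le> card {1..n}"
    using kn by simp
  then obtain T where T: "T \<subseteq> {1..n}" "card T = k" "\<And>A. A \<in> W \<Longrightarrow> A \<inter> T \<noteq> {}"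
    using obtain_hitting_set[OF finite_atLeastAtMost fin(2) W Wk] by metis
  then have TV: "T \<in> ?V"
    by (simp add: pverts_kneser)
  with T(3) have "T \<in> S"
    by (intro W_dominates) auto
  have "T \<notin> W"
  proof
    assume "T \<in> W"
    moreover have "W \<noteq> {T}"
      using cardW k by auto
    ultimately obtain B where "B \<in> W" "B \<noteq> T"
      by blast
    with \<open>T \<in> W\<close> T(3) disj show False
      by blast
  qed
  \<comment> \<open>As \<open>card W = k\<close>, the bound on \<open>card S + card W\<close> leaves
    \<open>S\<close> at most \<open>k + 1\<close> members.\<close>
  have "card S \<le> card (insert T W)"
    using SW cardW fin(2) \<open>T \<notin> W\<close> by simp
  then have "insert T W = S"
    using fin(1) sub(1) \<open>T \<in> S\<close> by (intro card_seteq) auto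
  moreover obtain B where "B \<in> S" "T \<inter> B = {}"
    using S_dominates TV by blast
  ultimately show False
    using T k by auto
qed

lemma exists_disjoint_vertices_kneser:
  assumes "k > 0" "n \<ge> k * m"
  obtains F where "F \<subseteq> pverts (kneser n k)" "card F = m" "disjoint F"
proof
  \<comment> \<open>Consecutive blocks of length \<open>k\<close>; \<open>bound\<close> separates
    two blocks and, with \<open>j = m\<close>, keeps the first \<open>m\<close> of them inside
    \<open>{1..n}\<close>.\<close>
  define B where "B i = {i * k + 1..i * k + k}" for i :: nat
  have bound: "i * k + k \<le> j * k" if "i < j" for i j
    using mult_le_mono1[of "Suc i" j k] that by simp
  have disj: "B i \<inter> B j = {}" if "i \<noteq> j" for i j
    using that bound[of i j] bound[of j i] by (cases "i < j") (auto simp: B_def)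
  have "B i \<noteq> {}" for i
    using assms(1) by (simp add: B_def)
  then have "inj B"
    using disj by (metis Int_absorb injI)
  then show "card (B ` {..<m}) = m"
    by (simp add: card_image inj_on_subset)
  show "disjoint (B ` {..<m})"
    by (rule pairwise_imageI) (simp add: disj disjnt_def)
  show "B ` {..<m} \<subseteq> pverts (kneser n k)"
  proof
    fix A assume "A \<in> B ` {..<m}"
    then obtain i where "i < m" "A = B i"
      by blast
    moreover have "i * k + k \<le> n"
      using bound[OF \<open>i < m\<close>] assms(2) by (simp add: mult.commute)
    ultimately show "A \<in> pverts (kneser n k)"
      by (auto simp: B_def pverts_kneser)
  qed
qed

text \<open>Pigeonhole: if \<open>A\<close> met every member, choosing a common point with each
  would inject \<open>F\<close> into \<open>A\<close>, since disjoint members get distinct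
  points.\<close>

lemma disjoint_family_avoids:
  assumes "disjoint F" "finite A" "card A < card F"
  shows "\<exists>B\<in>F. A \<inter> B = {}"
proof (rule ccontr)
  assume "\<not> ?thesis"
  then have "\<forall>B\<in>F. \<exists>x. x \<in> A \<inter> B"
    by blast
  then obtain g where g: "\<And>B. B \<in> F \<Longrightarrow> g B \<in> A \<inter> B"
    by metis
  have "inj_on g F"
  proof (rule inj_onI)
    fix B C assume "B \<in> F" "C \<in> F" "g B = g C"
    then have "\<not> disjnt B C"
      using g[of B] g[of C] by (auto simp: disjnt_iff)
    then show "B = C"
      using assms(1) \<open>B \<in> F\<close> \<open>C \<in> F\<close> by (meson pairwiseD)
  qed
  moreover have "g ` F \<subseteq> A"
    using g by blast
  ultimately have "card F \<le> card A"
    using assms(2) card_inj_on_le by blast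
  with assms(3) show False
    by simp
qed

lemma exists_TRDF_kneser:
  assumes k: "k > 0" and n: "n \<ge> k * (k + 1)"
  shows "\<exists>f. is_TRDF (kneser n k) f \<and> weight (kneser n k) f = 2 * (k + 1)"
proof -
  obtain F where F: "F \<subseteq> pverts (kneser n k)" "card F = k + 1" "disjoint F"
    using exists_disjoint_vertices_kneser[OF k n] .
  define f where "f A = (if A \<in> F then 2 else 0 :: nat)" for A
  \<comment> \<open>Proved for every vertex, members of \<open>F\<close> included, so that it also
    gives the condition on neighborhood sums.\<close>
  have dom: "\<exists>B\<in>open_nbhd (kneser n k) A. f B = 2" if A: "A \<in> pverts (kneser n k)" for A
  proof -
    have "finite A" "card A < card F"
      using A F(2) by (auto simp: pverts_kneser intro: finite_subset)
    then obtain B where "B \<in> F" "A \<inter> B = {}"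
      using disjoint_family_avoids F(3) by blast
    then show ?thesis
      using F(1) A by (auto simp: open_nbhd_kneser f_def)
  qed
  have "(\<Sum>B\<in>open_nbhd (kneser n k) A. f B) \<ge> 1" if A: "A \<in> pverts (kneser n k)" for A
  proof -
    obtain B where "B \<in> open_nbhd (kneser n k) A" "f B = 2"
      using dom[OF A] by blast
    then show ?thesis
      using A member_le_sum[of B "open_nbhd (kneser n k) A" f] by (simp add: open_nbhd_kneser)
  qed
  then have "is_TRDF (kneser n k) f"
    using dom by (auto simp: is_TRDF_def f_def)
  moreover have "weight (kneser n k) f = (\<Sum>A\<in>F. 2)"
    unfolding weight_def using F(1) by (intro sum.mono_neutral_cong_right) (auto simp: f_def)
  then have "weight (kneser n k) f = 2 * (k + 1)"
    by (simp add: F(2))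
  ultimately show ?thesis
    by blast
qed

theorem theorem2:
  fixes n k :: nat
  assumes "k > 1" and "n \<ge> k * (k + 1)"
  shows "total_Roman_domination_number (kneser n k) = 2 * (k + 1)"
  unfolding total_Roman_domination_number_def
proof (rule Least_equality)
  show "\<exists>f. is_TRDF (kneser n k) f \<and> weight (kneser n k) f = 2 * (k + 1)"
    using assms by (intro exists_TRDF_kneser) auto
  show "2 * (k + 1) \<le> w"
    if "\<exists>f. is_TRDF (kneser n k) f \<and> weight (kneser n k) f = w" for w
    using that weight_TRDF_kneser_ge[OF assms] by blast
qed

end
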